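(* Assume that there exists a sequence $(\alpha_n)_{n\in\mathbb{N}_0}$ of nonnegative real numbers with $w_{n,k}=\alpha_n$ for all $n\in\mathbb{N}_0$ and all $k\in T=\{0,1,2\}$. Then $d_{n,0}=d_{n,1}=d_{n,2}=:t_n$ for all $n\in\mathbb{N}_0$, and the sequence $(t_n)_{n\in\mathbb{N}_0}$ satisfies $$t_0=0,\qquad t_{n+1}=2t_n+\alpha_n,$$ whence $$t_n=\sum_{\nu=0}^{n-1}2^{n-1-\nu}\alpha_\nu .$$
   Context: Weighted Tower of Hanoi: $\mathbb{N}_0$ denotes the nonnegative integers; $T=\{0,1,2\}$ is the set of pegs; discs are labelled $1,2,3,\dots$ by increasing size. A state with $n$ discs is an assignment of the discs $1,\dots,n$ to the pegs, the discs on each peg being stacked with smaller discs above larger ones. A legal move transfers the topmost (smallest) disc of one peg to a different peg carrying no smaller disc. For $i\in T$, $i^n$ is the perfect state with all $n$ discs on peg $i$. For $\{i,j,k\}=T$ and $n\in\mathbb{N}_0$, $w_{n,k}\in[0,\infty)$ is a given cost of a single move of disc $n+1$ between pegs $i$ and $j$ (in either direction), and $d_{n,k}$ is the minimal total cost, over all finite sequences of legal moves, of getting from $i^n$ to $j^n$ with $n$ discs. An empty sum is zero. *)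

theory Defs
  imports Complex_Main "HOL-Library.FuncSet"
begin

definition pegs :: "nat set" where
  "pegs = {0, 1, 2}"

text \<open>
  Since the discs on a peg are stacked by size, a state is determined by the map from discs to pegs.
\<close>

definition states :: "nat \<Rightarrow> (nat \<Rightarrow> nat) set" where
  "states n = {1..n} \<rightarrow>\<^sub>E pegs"

definition perfect :: "nat \<Rightarrow> nat \<Rightarrow> nat \<Rightarrow> nat" where
  "perfect n i = (\<lambda>m\<in>{1..n}. i)"

text \<open>
  Disc \<open>m\<close> is the topmost disc of peg \<open>i\<close> and may be put on peg \<open>j\<close>.
\<close>

definition legal_move :: "nat \<Rightarrow> (nat \<Rightarrow> nat) \<Rightarrow> nat \<Rightarrow> nat \<Rightarrow> nat \<Rightarrow> bool" where
  "legal_move n s m i j \<longleftrightarrow>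
     m \<in> {1..n} \<and> s m = i \<and> i \<in> pegs \<and> j \<in> pegs \<and> i \<noteq> j \<and>
     (\<forall>l\<in>{1..n}. s l = i \<longrightarrow> m \<le> l) \<and>
     (\<forall>l\<in>{1..n}. s l = j \<longrightarrow> \<not> l < m)"

text \<open>
  \<open>path_cost w n s t c\<close>: some finite sequence of legal moves with \<open>n\<close> discs leads from \<open>s\<close> to \<open>t\<close>
  at total cost \<open>c\<close>. The weight \<open>w n k\<close> is the cost of moving disc \<open>n + 1\<close> between the two pegs
  other than \<open>k\<close>, hence the index \<open>m - 1\<close> for a move of disc \<open>m \<ge> 1\<close>.
\<close>

inductive path_cost ::
  "(nat \<Rightarrow> nat \<Rightarrow> real) \<Rightarrow> nat \<Rightarrow> (nat \<Rightarrow> nat) \<Rightarrow> (nat \<Rightarrow> nat) \<Rightarrow> real \<Rightarrow> bool"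
  for w n where
  empty: "s \<in> states n \<Longrightarrow> path_cost w n s s 0"
| move: "\<lbrakk>s \<in> states n; legal_move n s m i j; {i, j, k} = pegs; path_cost w n (s(m := j)) t c\<rbrakk>
    \<Longrightarrow> path_cost w n s t (w (m - 1) k + c)"

definition is_min_cost ::
  "(nat \<Rightarrow> nat \<Rightarrow> real) \<Rightarrow> nat \<Rightarrow> (nat \<Rightarrow> nat) \<Rightarrow> (nat \<Rightarrow> nat) \<Rightarrow> real \<Rightarrow> bool" where
  "is_min_cost w n s t c \<longleftrightarrow> path_cost w n s t c \<and> (\<forall>c'. path_cost w n s t c' \<longrightarrow> c \<le> c')"

text \<open>
  The index \<open>k\<close> leaves open which of the other two pegs is the initial one; for nonnegative weights
  the minimum exists and, moves being reversible at equal cost, does not depend on that choice.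
\<close>

definition hanoi_cost :: "(nat \<Rightarrow> nat \<Rightarrow> real) \<Rightarrow> nat \<Rightarrow> nat \<Rightarrow> real" where
  "hanoi_cost w n k =
     (THE c. \<forall>i j. {i, j, k} = pegs \<longrightarrow> is_min_cost w n (perfect n i) (perfect n j) c)"

end

theory Submission
  imports Defs
begin

text \<open>
  With weights that depend on the disc only, let \<open>t n\<close> be given by the recursion
  \<open>t (n + 1) = 2 t n + \<alpha> n\<close>. The classical recursive solution shows that \<open>t n\<close> is attained: carry
  the \<open>n\<close> small discs to the third peg, move disc \<open>n + 1\<close>, and carry the small discs on top of it
  (\<open>path_cost_tower\<close>).

  That nothing cheaper exists is shown by a potential. For an arbitrary state \<open>s\<close> let
  \<open>gather_cost \<alpha> n s j\<close> be the cost of the greedy strategy that gathers all discs on peg \<open>j\<close>: if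
  disc \<open>n + 1\<close> already lies on \<open>j\<close>, gather the smaller discs there; otherwise gather them on the
  third peg, move disc \<open>n + 1\<close> to \<open>j\<close> for \<open>\<alpha> n\<close>, and carry the tower of \<open>n\<close> discs to \<open>j\<close> for \<open>t n\<close>.
  One legal move lowers this potential by at most its own cost
  (\<open>gather_cost_legal_move\<close>), so every sequence of legal moves costs at least
  the difference of the potentials at its ends. Between two perfect states on different pegs this
  difference is \<open>t n\<close>. The potential makes it unnecessary to discuss how often or along which route
  the largest disc travels in an optimal solution.
\<close>

lemma mem_pegs_iff: "p \<in> pegs \<longleftrightarrow> p = 0 \<or> p = 1 \<or> p = 2"
  by (simp add: pegs_def)

lemma pegs_triple:
  assumes "{i, j, k} = pegs"
  shows "i \<in> pegs" "j \<in> pegs" "k \<in> pegs" "i \<noteq> j" "i \<noteq> k" "j \<noteq> k"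
proof -
  show "i \<in> pegs" "j \<in> pegs" "k \<in> pegs"
    using assms by auto
  have "card {i, j, k} = 3"
    by (simp add: assms pegs_def)
  then show "i \<noteq> j" "i \<noteq> k" "j \<noteq> k"
    by (auto simp: card_insert_if split: if_splits)
qed

text \<open>The pegs sum to 3, so \<open>3 - (i + j)\<close> is the peg other than \<open>i\<close> and \<open>j\<close>.\<close>

lemma third_peg:
  assumes "i \<in> pegs" "j \<in> pegs" "i \<noteq> j"
  shows "{i, j, 3 - (i + j)} = pegs"
  using assms unfolding mem_pegs_iff by (auto simp: pegs_def)

primrec tower_cost :: "(nat \<Rightarrow> real) \<Rightarrow> nat \<Rightarrow> real" where
  "tower_cost \<alpha> 0 = 0"
| "tower_cost \<alpha> (Suc n) = 2 * tower_cost \<alpha> n + \<alpha> n"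

lemma tower_cost_eq_sum: "tower_cost \<alpha> n = (\<Sum>\<nu><n. 2 ^ (n - 1 - \<nu>) * \<alpha> \<nu>)"
proof (induction n)
  case (Suc n)
  have "2 * (\<Sum>\<nu><n. 2 ^ (n - 1 - \<nu>) * \<alpha> \<nu>) = (\<Sum>\<nu><n. 2 ^ (n - \<nu>) * \<alpha> \<nu>)"
    unfolding sum_distrib_left
  proof (rule sum.cong)
    fix \<nu> assume "\<nu> \<in> {..<n}"
    then have "n - \<nu> = Suc (n - 1 - \<nu>)"
      by auto
    then show "2 * (2 ^ (n - 1 - \<nu>) * \<alpha> \<nu>) = 2 ^ (n - \<nu>) * \<alpha> \<nu>"
      by simp
  qed simp
  with Suc.IH show ?case
    by simp
qed simp

section \<open>Attaining the tower cost\<close>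

lemma states_Suc: "s \<in> states n \<Longrightarrow> p \<in> pegs \<Longrightarrow> s(Suc n := p) \<in> states (Suc n)"
  by (auto simp: states_def PiE_iff extensional_def le_Suc_eq)

lemma perfect_in_states: "p \<in> pegs \<Longrightarrow> perfect n p \<in> states n"
  by (auto simp: states_def perfect_def)

lemma perfect_Suc: "perfect (Suc n) p = (perfect n p)(Suc n := p)"
  by (rule ext) (auto simp: perfect_def)

lemma path_cost_trans:
  assumes "path_cost w n s u a" and "path_cost w n u t b"
  shows "path_cost w n s t (a + b)"
  using assms
proof (induction rule: path_cost.induct)
  case (move s m i j k u c)
  have "path_cost w n s t (w (m - 1) k + (c + b))"
    by (rule path_cost.move[OF move.hyps(1-3) move.IH[OF move.prems]])
  then show ?case
    by (simp add: add.assoc)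
qed simp

text \<open>A larger disc never obstructs the smaller ones, so it may be put below any sequence of moves.\<close>

lemma path_cost_Suc:
  assumes "path_cost w n s t c" and "p \<in> pegs"
  shows "path_cost w (Suc n) (s(Suc n := p)) (t(Suc n := p)) c"
  using assms
proof (induction rule: path_cost.induct)
  case (empty s)
  then show ?case
    by (intro path_cost.empty states_Suc)
next
  case (move s m i j k t c)
  have "m \<noteq> Suc n"
    using move.hyps(2) by (auto simp: legal_move_def)
  then have "(s(m := j))(Suc n := p) = (s(Suc n := p))(m := j)"
    by (simp add: fun_upd_twist)
  moreover have "legal_move (Suc n) (s(Suc n := p)) m i j"
    using move.hyps(2) by (auto simp: legal_move_def le_Suc_eq)
  ultimately show ?case
    using move.hyps(3) move.IH[OF move.prems] states_Suc[OF move.hyps(1) move.prems]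
    by (metis path_cost.move)
qed

lemma path_cost_tower:
  assumes w: "\<forall>n. \<forall>k\<in>pegs. w n k = \<alpha> n"
    and "i \<in> pegs" "j \<in> pegs" "i \<noteq> j"
  shows "path_cost w n (perfect n i) (perfect n j) (tower_cost \<alpha> n)"
  using assms(2-)
proof (induction n arbitrary: i j)
  case 0
  have "perfect 0 i = perfect 0 j"
    by (rule ext) (simp add: perfect_def)
  then show ?case
    using path_cost.empty[OF perfect_in_states[OF 0(1), of 0]] by simp
next
  case (Suc n)
  define k where "k = 3 - (i + j)"
  have ijk: "{i, j, k} = pegs"
    unfolding k_def by (rule third_peg[OF Suc.prems])
  note k = pegs_triple[OF ijk]
  let ?s = "(perfect n k)(Suc n := i)" and ?t = "(perfect n k)(Suc n := j)"
  have first: "path_cost w (Suc n) (perfect (Suc n) i) ?s (tower_cost \<alpha> n)"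
    unfolding perfect_Suc using k by (intro path_cost_Suc Suc.IH) auto
  have last: "path_cost w (Suc n) ?t (perfect (Suc n) j) (tower_cost \<alpha> n)"
    unfolding perfect_Suc using k by (intro path_cost_Suc Suc.IH) auto
  have "legal_move (Suc n) ?s (Suc n) i j"
    using k by (auto simp: legal_move_def perfect_def)
  moreover have "?s \<in> states (Suc n)"
    using k by (intro states_Suc perfect_in_states)
  ultimately have "path_cost w (Suc n) ?s (perfect (Suc n) j) (w (Suc n - 1) k + tower_cost \<alpha> n)"
    using ijk last by (intro path_cost.move[where i = i and j = j]) (simp_all only: fun_upd_upd)
  from path_cost_trans[OF first this] have
    "path_cost w (Suc n) (perfect (Suc n) i) (perfect (Suc n) j)
      (tower_cost \<alpha> n + (w (Suc n - 1) k + tower_cost \<alpha> n))" .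
  moreover have "tower_cost \<alpha> n + (w (Suc n - 1) k + tower_cost \<alpha> n) = tower_cost \<alpha> (Suc n)"
    using w k(3) by simp
  ultimately show ?case
    by simp
qed

section \<open>The lower bound by a potential\<close>

primrec gather_cost :: "(nat \<Rightarrow> real) \<Rightarrow> nat \<Rightarrow> (nat \<Rightarrow> nat) \<Rightarrow> nat \<Rightarrow> real" where
  "gather_cost \<alpha> 0 s j = 0"
| "gather_cost \<alpha> (Suc n) s j =
    (if s (Suc n) = j then gather_cost \<alpha> n s j
     else gather_cost \<alpha> n s (3 - (s (Suc n) + j)) + \<alpha> n + tower_cost \<alpha> n)"

lemma gather_cost_cong:
  "(\<And>l. l \<in> {1..n} \<Longrightarrow> s l = s' l) \<Longrightarrow> gather_cost \<alpha> n s j = gather_cost \<alpha> n s' j"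
  by (induction n arbitrary: j) auto

lemma gather_cost_tower:
  assumes "\<And>l. l \<in> {1..n} \<Longrightarrow> s l = k" and "k \<in> pegs" "j \<in> pegs"
  shows "gather_cost \<alpha> n s j = (if k = j then 0 else tower_cost \<alpha> n)"
  using assms
proof (induction n arbitrary: j)
  case (Suc n)
  have IH: "gather_cost \<alpha> n s j' = (if k = j' then 0 else tower_cost \<alpha> n)" if "j' \<in> pegs" for j'
    using Suc.prems that by (intro Suc.IH) auto
  have sk: "s (Suc n) = k"
    using Suc.prems(1) by simp
  show ?case
  proof (cases "k = j")
    case False
    note third = pegs_triple[OF third_peg[OF Suc.prems(2,3) False]]
    then show ?thesis
      using False sk IH[OF third(3)] by simp
  qed (use sk IH[OF Suc.prems(3)] in simp)
qed simp

text \<open>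
  A move of the largest disc from \<open>p\<close> to \<open>q\<close> forces all smaller discs onto the third peg, where the
  potential is known exactly. If \<open>q\<close> is the target, the potential falls by exactly the cost of the
  move; if \<open>p\<close> is, it does not fall; and if the smaller discs occupy the target, it is the same
  for both positions of the largest disc. Any other move leaves the largest disc in place, and with
  it the peg on which the smaller discs are to be gathered, so the bound for the smaller discs
  carries over.
\<close>

lemma gather_cost_legal_move:
  assumes nonneg: "\<And>n. 0 \<le> \<alpha> n"
    and "legal_move n s m p q" and "\<And>l. l \<in> {1..n} \<Longrightarrow> s l \<in> pegs" and "j \<in> pegs"
  shows "gather_cost \<alpha> n s j \<le> \<alpha> (m - 1) + gather_cost \<alpha> n (s(m := q)) j"
  using assms(2-)
proof (induction n arbitrary: j)
  case 0
  then show ?case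
    by (simp add: legal_move_def)
next
  case (Suc n)
  show ?case
  proof (cases "m = Suc n")
    case False
    then have move: "legal_move n s m p q"
      using Suc.prems(1) by (auto simp: legal_move_def)
    have IH: "gather_cost \<alpha> n s j' \<le> \<alpha> (m - 1) + gather_cost \<alpha> n (s(m := q)) j'"
      if "j' \<in> pegs" for j'
      using Suc.prems(2) that by (intro Suc.IH move) auto
    show ?thesis
    proof (cases "s (Suc n) = j")
      case True
      then show ?thesis
        using IH[OF Suc.prems(3)] False by (simp del: fun_upd_apply add: fun_upd_other)
    next
      case neq: False
      have "s (Suc n) \<in> pegs"
        using Suc.prems(2) by simp
      then have "3 - (s (Suc n) + j) \<in> pegs"
        using pegs_triple(3)[OF third_peg] Suc.prems(3) neq by blast
      from IH[OF this] show ?thesis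
        using neq False by (simp del: fun_upd_apply add: fun_upd_other)
    qed
  next
    case m: True
    define k where "k = 3 - (p + q)"
    have sp: "s (Suc n) = p" and pq: "p \<in> pegs" "q \<in> pegs" "p \<noteq> q"
      using Suc.prems(1) m by (auto simp: legal_move_def)
    have pqk: "{p, q, k} = pegs"
      unfolding k_def by (rule third_peg[OF pq])
    note k = pegs_triple[OF pqk]
    have on_k: "s l = k" if "l \<in> {1..n}" for l
    proof -
      have "s l \<noteq> p" "s l \<noteq> q"
        using Suc.prems(1) m that by (auto simp: legal_move_def)
      moreover have "s l \<in> {p, q, k}"
        unfolding pqk using that by (intro Suc.prems(2)) auto
      ultimately show ?thesis
        by simp
    qed
    have before: "gather_cost \<alpha> n s j' = (if k = j' then 0 else tower_cost \<alpha> n)"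
      if "j' \<in> pegs" for j'
      using that by (intro gather_cost_tower on_k k(3))
    have after: "gather_cost \<alpha> n (s(Suc n := q)) j' = gather_cost \<alpha> n s j'" for j'
      by (rule gather_cost_cong) auto
    have thirds: "3 - (p + q) = k" "3 - (q + p) = k" "3 - (p + k) = q" "3 - (q + k) = p"
      using pq by (auto simp: k_def mem_pegs_iff)
    consider "j = p" | "j = q" | "j = k"
      using Suc.prems(3) pqk by blast
    then show ?thesis
    proof cases
      case 1
      then show ?thesis
        using k sp m nonneg[of n] by (simp del: fun_upd_apply add: fun_upd_same after before thirds)
    next
      case 2
      then show ?thesis
        using k sp m by (simp del: fun_upd_apply add: fun_upd_same after before thirds)
    next
      case 3
      then show ?thesis
        using k sp m nonneg[of n] by (simp del: fun_upd_apply add: fun_upd_same after before thirds)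
    qed
  qed
qed

lemma gather_cost_le_path_cost:
  assumes w: "\<forall>n. \<forall>k\<in>pegs. w n k = \<alpha> n" and nonneg: "\<And>n. 0 \<le> \<alpha> n"
    and "path_cost w n s t c" and j: "j \<in> pegs"
  shows "gather_cost \<alpha> n s j \<le> c + gather_cost \<alpha> n t j"
  using assms(3)
proof (induction rule: path_cost.induct)
  case (move s m p q k t c)
  have "gather_cost \<alpha> n s j \<le> \<alpha> (m - 1) + gather_cost \<alpha> n (s(m := q)) j"
    using move.hyps(1) by (intro gather_cost_legal_move[OF nonneg move.hyps(2) _ j])
      (auto simp: states_def)
  with move.IH have "gather_cost \<alpha> n s j \<le> \<alpha> (m - 1) + c + gather_cost \<alpha> n t j"
    by linarith
  moreover have "w (m - 1) k = \<alpha> (m - 1)"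
    using w pegs_triple(3)[OF move.hyps(3)] by blast
  ultimately show ?case
    by simp
qed simp

lemma is_min_cost_tower:
  assumes w: "\<forall>n. \<forall>k\<in>pegs. w n k = \<alpha> n" and nonneg: "\<And>n. 0 \<le> \<alpha> n"
    and "i \<in> pegs" "j \<in> pegs" "i \<noteq> j"
  shows "is_min_cost w n (perfect n i) (perfect n j) (tower_cost \<alpha> n)"
  unfolding is_min_cost_def
proof (intro conjI allI impI)
  show "path_cost w n (perfect n i) (perfect n j) (tower_cost \<alpha> n)"
    using assms(3-) by (rule path_cost_tower[OF w])
next
  fix c assume "path_cost w n (perfect n i) (perfect n j) c"
  from gather_cost_le_path_cost[OF w nonneg this assms(4)]
  have "gather_cost \<alpha> n (perfect n i) j \<le> c + gather_cost \<alpha> n (perfect n j) j" .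
  moreover have "gather_cost \<alpha> n (perfect n p) j = (if p = j then 0 else tower_cost \<alpha> n)"
    if "p \<in> pegs" for p
    using that assms(4) by (intro gather_cost_tower) (auto simp: perfect_def)
  ultimately show "tower_cost \<alpha> n \<le> c"
    using assms(3-) by simp
qed

section \<open>The cost of the weighted Tower of Hanoi\<close>

lemma hanoi_cost_eq_tower_cost:
  assumes w: "\<forall>n. \<forall>k\<in>pegs. w n k = \<alpha> n" and nonneg: "\<And>n. 0 \<le> \<alpha> n"
    and k: "k \<in> pegs"
  shows "hanoi_cost w n k = tower_cost \<alpha> n"
  unfolding hanoi_cost_def
proof (rule the_equality)
  show "\<forall>i j. {i, j, k} = pegs \<longrightarrow>
      is_min_cost w n (perfect n i) (perfect n j) (tower_cost \<alpha> n)"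
    using pegs_triple(1,2,4) by (intro allI impI is_min_cost_tower[OF w nonneg])
next
  fix c
  assume c: "\<forall>i j. {i, j, k} = pegs \<longrightarrow> is_min_cost w n (perfect n i) (perfect n j) c"
  \<comment> \<open>Without an actual pair of pegs the description would be vacuous and \<open>c\<close> not unique.\<close>
  obtain i j where ij: "{i, j, k} = pegs"
  proof -
    define i :: nat where "i = (if k = 0 then 1 else 0)"
    have i: "i \<in> pegs" "i \<noteq> k"
      by (simp_all add: i_def mem_pegs_iff)
    have "{i, 3 - (i + k), k} = pegs"
      using third_peg[OF i(1) k i(2)] by (simp only: insert_commute)
    then show ?thesis
      by (rule that)
  qed
  have "is_min_cost w n (perfect n i) (perfect n j) (tower_cost \<alpha> n)"
    using pegs_triple[OF ij] by (intro is_min_cost_tower[OF w nonneg])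
  moreover have "is_min_cost w n (perfect n i) (perfect n j) c"
    using c ij by blast
  ultimately show "c = tower_cost \<alpha> n"
    unfolding is_min_cost_def by (intro antisym) simp_all
qed

theorem theorem3:
  fixes w :: "nat \<Rightarrow> nat \<Rightarrow> real" and \<alpha> :: "nat \<Rightarrow> real"
  assumes "\<And>n k. k \<in> pegs \<Longrightarrow> 0 \<le> w n k"
    and "\<And>n. 0 \<le> \<alpha> n"
    and "\<And>n k. k \<in> pegs \<Longrightarrow> w n k = \<alpha> n"
  shows "\<exists>t :: nat \<Rightarrow> real.
    (\<forall>n. hanoi_cost w n 0 = t n \<and> hanoi_cost w n 1 = t n \<and> hanoi_cost w n 2 = t n) \<and>
    t 0 = 0 \<and>
    (\<forall>n. t (n + 1) = 2 * t n + \<alpha> n) \<and>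
    (\<forall>n. t n = (\<Sum>\<nu><n. 2 ^ (n - 1 - \<nu>) * \<alpha> \<nu>))"
proof (intro exI conjI allI)
  have cost: "hanoi_cost w n k = tower_cost \<alpha> n" if "k \<in> pegs" for n k
    using assms(2,3) that by (intro hanoi_cost_eq_tower_cost) simp_all
  fix n
  show "hanoi_cost w n 0 = tower_cost \<alpha> n" "hanoi_cost w n 1 = tower_cost \<alpha> n"
    "hanoi_cost w n 2 = tower_cost \<alpha> n"
    by (simp_all add: cost pegs_def)
  show "tower_cost \<alpha> 0 = 0" "tower_cost \<alpha> (n + 1) = 2 * tower_cost \<alpha> n + \<alpha> n"
    by simp_all
  show "tower_cost \<alpha> n = (\<Sum>\<nu><n. 2 ^ (n - 1 - \<nu>) * \<alpha> \<nu>)"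
    by (rule tower_cost_eq_sum)
qed

end
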